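(* Let $\Gamma_E$ be the Eulerian function with parameters $a,b$ (with $\operatorname{Re} b>0$), i.e. the interpolation, as specified in the context, of $$\Gamma_E(i)=a\,(a+b)(a+2b)\cdots(a+(i-1)b),\qquad i=1,2,3,\dots$$ Then the constant $A$ in Euler's asymptotic formula $$\Gamma_E(x)\sim A\,(a-b+bx)^{\frac{a}{b}+x-\frac12}\,e^{-x}\qquad\text{for } x\to\infty$$ is $$A=\frac{\sqrt{2\pi}}{\Gamma\left(\frac{a}{b}\right)}\cdot e^{-\frac{a}{b}+1}\cdot b^{\frac12-\frac{a}{b}}.$$
   Context: $\Gamma$ is the usual Gamma function, $\Gamma(x)=\int_0^\infty t^{x-1}e^{-t}\,dt$ for $\operatorname{Re}(x)>0$. The notation $f(x)\sim g(x)$ for $x\to\infty$ means $f(x)/g(x)\to 1$ as $x$ tends to $+\infty$. The Eulerian function $\Gamma_E$ is given for natural numbers $i$ by the product $a(a+b)(a+2b)\cdots(a+(i-1)b)$. It is interpolated to other arguments $x$ by the functional equation $\Gamma_E(x+1)=(a+bx)\,\Gamma_E(x)$ together with the initial condition $\Gamma_E(1)=a$, and it is assumed to be logarithmically convex for positive real numbers $x$ satisfying $\operatorname{Re}\left(x-1+\frac{a}{b}\right)>0$.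
   Formalization: For complex values, logarithmic convexity is read as convexity of ln|Γ_E|, plus an added condition: the argument of Γ_E has a convex or concave branch increasing by Arg(a+bx) from x to x+1. Without it Γ_E(x)e^{2πix} is a counterexample; it is automatic when Γ_E is positive. *)

theory Defs
  imports "HOL-Analysis.Analysis" "HOL-Library.Landau_Symbols"
begin

definition eulerian_domain :: "complex \<Rightarrow> complex \<Rightarrow> real set" where
  "eulerian_domain a b = {x. 0 < x \<and> 0 < Re (of_real x - 1 + a / b)}"

(* For a complex-valued function, logarithmic convexity is convexity of Re (log f) = ln |f|. *)
definition log_convex_on :: "real set \<Rightarrow> (real \<Rightarrow> complex) \<Rightarrow> bool" where
  "log_convex_on S f \<longleftrightarrow>
     (\<forall>x\<in>S. f x \<noteq> 0) \<and> convex_on S (\<lambda>x. ln (norm (f x)))"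

(* Log-convexity of |f| says nothing about the argument of f: multiplying a solution of the
   functional equation by exp (2 pi i x) preserves everything else below. A real function that is
   logarithmically convex in the usual sense takes positive values, and then \<theta> = 0 works (lemma
   eulerian_phase_of_pos); for complex parameters \<theta> is the imaginary part of the branch of
   log f on which the functional equation reads log f(x+1) = log f(x) + Ln (a + b x). *)
definition eulerian_phase :: "complex \<Rightarrow> complex \<Rightarrow> (real \<Rightarrow> complex) \<Rightarrow> bool" where
  "eulerian_phase a b f \<longleftrightarrow>
     (\<exists>\<theta> :: real \<Rightarrow> real.
        (\<forall>x\<in>eulerian_domain a b.
           f x = of_real (norm (f x)) * cis (\<theta> x) \<and>
           \<theta> (x + 1) = \<theta> x + Arg (a + b * of_real x)) \<and>
        (convex_on (eulerian_domain a b) \<theta> \<or> concave_on (eulerian_domain a b) \<theta>))"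

(* The functional equation is not imposed at the zero x = -a/b of a + b x, where the interpolation
   has a pole; imposing it there would force f to vanish at 1 - a/b, 2 - a/b, ... *)
definition eulerian_function :: "complex \<Rightarrow> complex \<Rightarrow> (real \<Rightarrow> complex) \<Rightarrow> bool" where
  "eulerian_function a b f \<longleftrightarrow>
     (\<forall>i::nat. 1 \<le> i \<longrightarrow> f (real i) = (\<Prod>k<i. a + of_nat k * b)) \<and>
     f 1 = a \<and>
     (\<forall>x>0. a + b * of_real x \<noteq> 0 \<longrightarrow> f (x + 1) = (a + b * of_real x) * f x) \<and>
     log_convex_on (eulerian_domain a b) f \<and>
     eulerian_phase a b f"

lemma convex_eulerian_domain: "convex (eulerian_domain a b)"
proof -
  have "eulerian_domain a b = {0<..} \<inter> {1 - Re (a / b)<..}"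
    by (auto simp: eulerian_domain_def)
  then show ?thesis
    by (simp add: convex_Int)
qed

lemma eulerian_phase_of_pos:
  assumes b: "b \<noteq> 0"
    and rec: "\<And>x. 0 < x \<Longrightarrow> a + b * of_real x \<noteq> 0 \<Longrightarrow> f (x + 1) = (a + b * of_real x) * f x"
    and pos: "\<And>x. x \<in> eulerian_domain a b \<Longrightarrow> \<exists>r>0. f x = complex_of_real r"
  shows "eulerian_phase a b f"
proof -
  have "f x = of_real (norm (f x)) \<and> Arg (a + b * of_real x) = 0"
    if x: "x \<in> eulerian_domain a b" for x
  proof -
    have x1: "x + 1 \<in> eulerian_domain a b" and x0: "0 < x" and re: "0 < Re (of_real x - 1 + a / b)"
      using x by (auto simp: eulerian_domain_def)
    have nz: "a + b * of_real x \<noteq> 0"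
    proof
      assume *: "a + b * of_real x = 0"
      have "a / b + of_real x = (a + b * of_real x) / b"
        using b by (simp add: field_simps)
      then have "of_real x - 1 + a / b = -1"
        using * by (simp add: algebra_simps)
      with re show False by simp
    qed
    obtain r s where r: "r > 0" "f x = complex_of_real r" and s: "s > 0" "f (x + 1) = complex_of_real s"
      using pos[OF x] pos[OF x1] by blast
    have "a + b * of_real x = complex_of_real (s / r)"
      using rec[OF x0 nz] r s by (simp add: field_simps)
    moreover have "s / r > 0" using r s by simp
    ultimately have "Arg (a + b * of_real x) = 0"
      by (simp only: Arg_of_real) simp
    then show ?thesis using r by simp
  qed
  moreover have "convex_on (eulerian_domain a b) (\<lambda>_. 0 :: real)"
    by (simp add: convex_on_def convex_eulerian_domain)
  ultimately show ?thesis
    unfolding eulerian_phase_def by (intro exI[of _ "\<lambda>_. 0"]) auto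
qed

end

theory Submission
  imports Defs "HOL-Real_Asymp.Real_Asymp"
begin

text \<open>
  A convex or concave function \<open>g\<close> with \<open>g (x + 1) = g x + h x\<close> is squeezed between its secants, so
  \<open>g (n + t) = g n + t * h n + o(1)\<close> uniformly in \<open>0 \<le> t \<le> 1\<close> as soon as \<open>h (x + 1) - h x\<close> tends to 0.
  Applied to the logarithm of the modulus and to the phase, with \<open>h\<close> the real and imaginary part of
  \<open>Ln (a + b x)\<close>, this gives \<open>\<Gamma>\<^sub>E x = \<Gamma>\<^sub>E n * exp (t * Ln (a + b n) + o(1))\<close> for \<open>n = \<lfloor>x\<rfloor>\<close> and
  \<open>t = x - n\<close>. The values at integers are \<open>b ^ n * pochhammer (a / b) n\<close>, whose asymptotics follow
  from Gauss' limit formula for \<open>\<Gamma>\<close> and Stirling's formula for \<open>n!\<close>. The remaining comparison uses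
  only \<open>Ln (x + d) = ln x + d / x + o(1 / x)\<close>.
\<close>

section \<open>Stirling's formula for the factorial\<close>

text \<open>The shift 1/2 in the factor of the logarithm cancels the 1/n term of the increments.
  They are then O(1/n^2), hence summable, and the remainder converges by telescoping. The limit
  itself is found only in \<open>stirling_ln_fact\<close>.\<close>

lemma stirling_remainder_convergent:
  "convergent (\<lambda>n. ln (fact n) - (real n + 1/2) * ln (real n) + real n)"
proof -
  define s where "s n = ln (fact n) - (real n + 1/2) * ln (real n) + real n" for n
  have diff: "s (Suc n) - s n = 1 - (real n + 1/2) * (ln (real n + 1) - ln (real n))" if "n > 0" for n
  proof -
    have "ln (fact (Suc n) :: real) = ln (real n + 1) + ln (fact n)"
      by (simp add: ln_mult add.commute)
    then show ?thesis by (simp add: s_def algebra_simps)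
  qed
  have "(\<lambda>n. 1 - (real n + 1/2) * (ln (real n + 1) - ln (real n))) \<in> O(\<lambda>n. 1 / real n ^ 2)"
    by real_asymp
  moreover have "eventually (\<lambda>n. s (Suc n) - s n
      = 1 - (real n + 1/2) * (ln (real n + 1) - ln (real n))) sequentially"
    using eventually_gt_at_top[of 0] by eventually_elim (rule diff)
  ultimately have "(\<lambda>n. s (Suc n) - s n) \<in> O(\<lambda>n. 1 / real n ^ 2)"
    by (simp cong: landau_o.big.in_cong)
  moreover have "summable (\<lambda>n. norm (1 / real n ^ 2))"
    using inverse_power_summable[of 2, where ?'a = real] by (simp add: field_simps)
  ultimately have "summable (\<lambda>n. s (Suc n) - s n)"
    by (rule summable_comparison_test_bigo[rotated])
  then have "convergent (\<lambda>n. s n - s 0)"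
    by (simp add: summable_iff_convergent sum_lessThan_telescope)
  then have "convergent s"
    by (simp add: convergent_diff_const_right_iff)
  then show ?thesis unfolding s_def .
qed

text \<open>This takes the place of Wallis' product. Duplication turns the central binomial
  coefficient into \<open>pochhammer (1/2) n / fact n\<close>, and Gauss' limit formula at 1/2
  together with Gamma(1/2) = sqrt pi gives the limit.\<close>

lemma central_binomial_tendsto:
  "(\<lambda>n. fact (2 * n) / (4 ^ n * (fact n)\<^sup>2) * sqrt (real n)) \<longlonglongrightarrow> 1 / sqrt pi"
proof -
  have "(\<lambda>n. inverse (Gamma_series' (1/2 :: real) n)) \<longlonglongrightarrow> inverse (sqrt pi)"
    using Gamma_series'_LIMSEQ[of "1/2 :: real"] Gamma_one_half_real
    by (intro tendsto_inverse) auto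
  moreover have "eventually (\<lambda>n. inverse (Gamma_series' (1/2) n)
      = fact (2 * n) / (4 ^ n * (fact n)\<^sup>2) * sqrt (real n)) sequentially"
    using eventually_gt_at_top[of 0]
  proof eventually_elim
    case (elim n)
    have e: "exp (ln (real n) / 2) = sqrt (real n)"
      using elim by (simp flip: ln_sqrt)
    have f: "(fact n :: real) = sqrt (real n) * sqrt (real n) * fact (n - 1)"
      by (simp add: fact_reduce[OF elim])
    have p: "(fact (2 * n) :: real) = 4 ^ n * pochhammer (1/2) n * fact n"
      using fact_double[of n, where ?'a = real] by (simp add: power_mult)
    have "inverse (Gamma_series' (1/2) n) = pochhammer (1/2) n / (fact (n - 1) * sqrt (real n))"
      by (simp add: Gamma_series'_def e)
    also have "\<dots> = pochhammer (1/2) n / fact n * sqrt (real n)"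
      using elim unfolding f by (simp del: real_sqrt_mult_self)
    also have "\<dots> = fact (2 * n) / (4 ^ n * (fact n)\<^sup>2) * sqrt (real n)"
      by (simp add: p power2_eq_square)
    finally show ?case .
  qed
  ultimately show ?thesis
    by (auto simp: inverse_eq_divide intro: Lim_transform_eventually)
qed

lemma stirling_ln_fact:
  "(\<lambda>n. ln (fact n) - (real n + 1/2) * ln (real n) + real n) \<longlonglongrightarrow> ln (sqrt (2 * pi))"
proof -
  define s where "s n = ln (fact n) - (real n + 1/2) * ln (real n) + real n" for n
  define q where "q n = fact (2 * n) / (4 ^ n * (fact n)\<^sup>2) * sqrt (real n)" for n
  obtain C where C: "s \<longlonglongrightarrow> C"
    using stirling_remainder_convergent unfolding s_def convergent_def by blast
  \<comment> \<open>In this combination the terms of order n ln n and n cancel, so only the central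
    binomial coefficient and ln 2 / 2 remain. Its limit 2 C - C = C therefore determines the
    constant.\<close>
  have "(\<lambda>n. 2 * s n - s (2 * n)) \<longlonglongrightarrow> 2 * C - C"
    by (intro tendsto_intros C filterlim_compose[OF C] mult_nat_left_at_top) auto
  moreover have "(\<lambda>n. ln 2 / 2 - ln (q n)) \<longlonglongrightarrow> ln 2 / 2 - ln (1 / sqrt pi)"
    unfolding q_def by (intro tendsto_intros central_binomial_tendsto) auto
  moreover have "eventually (\<lambda>n. ln 2 / 2 - ln (q n) = 2 * s n - s (2 * n)) sequentially"
    using eventually_gt_at_top[of 0]
  proof eventually_elim
    case (elim n)
    have "ln (4 :: real) = 2 * ln 2"
      using ln_realpow[of 2 2] by simp
    then have "ln (q n) = ln (fact (2 * n)) - real n * (2 * ln 2) - 2 * ln (fact n) + ln (real n) / 2"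
      using elim by (simp add: q_def ln_mult ln_div ln_realpow ln_sqrt)
    then show ?case
      using elim by (simp add: s_def ln_mult algebra_simps)
  qed
  ultimately have "(\<lambda>n. 2 * s n - s (2 * n)) \<longlonglongrightarrow> 2 * C - C"
      "(\<lambda>n. 2 * s n - s (2 * n)) \<longlonglongrightarrow> ln 2 / 2 - ln (1 / sqrt pi)"
    by (auto intro: Lim_transform_eventually)
  then have "2 * C - C = ln 2 / 2 - ln (1 / sqrt pi)"
    by (rule LIMSEQ_unique)
  then have "C = ln (sqrt (2 * pi))"
    by (simp add: ln_div ln_mult ln_sqrt real_sqrt_mult)
  then show ?thesis using C unfolding s_def by simp
qed

section \<open>Convex functions with a prescribed unit increment\<close>

text \<open>By the recurrence the secants of \<open>g\<close> over [y - 1, y] and [y, y + 1] have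
  slopes \<open>h (y - 1)\<close> and \<open>h y\<close>. On [y, y + 1] the function lies below the
  second secant and above the extension of the first.\<close>

lemma convex_unit_step_bound:
  fixes g h :: "real \<Rightarrow> real"
  assumes g: "convex_on S g" and S: "y - 1 \<in> S" "y \<in> S" "y + 1 \<in> S"
    and rec: "\<And>x. x \<in> S \<Longrightarrow> g (x + 1) = g x + h x"
    and t: "0 \<le> t" "t \<le> 1"
  shows "\<bar>g (y + t) - g y - t * h y\<bar> \<le> \<bar>h y - h (y - 1)\<bar>"
proof -
  have upper: "g (y + t) \<le> g y + t * h y"
    using convex_onD[OF g, of t y "y + 1"] t S rec[of y] by (simp add: algebra_simps)
  have "y + t \<in> S"
    using convexD_alt[OF convex_on_imp_convex[OF g], of y "y + 1" t] S t
    by (simp add: algebra_simps)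
  \<comment> \<open>The weight that makes \<open>y\<close> the convex combination of
    \<open>y + t\<close> and \<open>y - 1\<close>. Clearing the denominator 1 + t below gives the
    extrapolated lower bound.\<close>
  moreover define u where "u = t / (1 + t)"
  have u: "0 \<le> u" "u \<le> 1" "(1 - u) * (1 + t) = 1" "u * (1 + t) = t"
    using t by (auto simp: u_def field_simps)
  have "(1 - u) * (y + t) + u * (y - 1) = y"
    using u(3,4) by (simp add: algebra_simps)
  ultimately have "g y \<le> (1 - u) * g (y + t) + u * g (y - 1)"
    using convex_onD[OF g u(1,2), of "y + t" "y - 1"] S by simp
  then have "g y * (1 + t) \<le> ((1 - u) * g (y + t) + u * g (y - 1)) * (1 + t)"
    using t by (intro mult_right_mono) auto
  also have "\<dots> = (1 - u) * (1 + t) * g (y + t) + u * (1 + t) * g (y - 1)"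
    by (simp only: algebra_simps)
  also have "\<dots> = g (y + t) + t * g (y - 1)"
    by (simp only: u(3,4) mult_1)
  finally have "g y * (1 + t) \<le> g (y + t) + t * g (y - 1)" .
  then have lower: "g y + t * h (y - 1) \<le> g (y + t)"
    using rec[of "y - 1"] S by (simp add: algebra_simps)
  have "\<bar>g (y + t) - g y - t * h y\<bar> \<le> t * (h y - h (y - 1))"
    using upper lower by (simp add: abs_le_iff algebra_simps)
  also have "\<dots> \<le> t * \<bar>h y - h (y - 1)\<bar>"
    using t by (intro mult_left_mono) auto
  also have "\<dots> \<le> \<bar>h y - h (y - 1)\<bar>"
    using t by (intro mult_left_le_one_le) auto
  finally show ?thesis .
qed

lemma filterlim_of_int_floor_at_top: "filterlim (\<lambda>x::real. real_of_int \<lfloor>x\<rfloor>) at_top at_top"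
proof (rule filterlim_at_top_mono)
  show "filterlim (\<lambda>x::real. x - 1) at_top at_top" by real_asymp
  show "eventually (\<lambda>x. x - 1 \<le> real_of_int \<lfloor>x\<rfloor>) at_top"
    by (intro always_eventually) linarith
qed

lemma convex_interpolation_tendsto:
  fixes g h :: "real \<Rightarrow> real"
  assumes g: "convex_on {m<..} g \<or> concave_on {m<..} g"
    and rec: "\<And>x. m < x \<Longrightarrow> g (x + 1) = g x + h x"
    and h: "((\<lambda>x. h (x + 1) - h x) \<longlongrightarrow> 0) at_top"
  shows "((\<lambda>x. g x - g (of_int \<lfloor>x\<rfloor>) - frac x * h (of_int \<lfloor>x\<rfloor>)) \<longlongrightarrow> 0) at_top"
proof (rule Lim_null_comparison)
  have lim: "filterlim (\<lambda>x::real. real_of_int \<lfloor>x\<rfloor> - 1) at_top at_top"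
    using filterlim_of_int_floor_at_top
    by (rule filterlim_compose[rotated]) real_asymp
  have "((\<lambda>x::real. \<bar>h (of_int \<lfloor>x\<rfloor> - 1 + 1) - h (of_int \<lfloor>x\<rfloor> - 1)\<bar>) \<longlongrightarrow> 0) at_top"
    using tendsto_rabs_zero[OF filterlim_compose[OF h lim]] .
  then show "((\<lambda>x::real. \<bar>h (of_int \<lfloor>x\<rfloor>) - h (of_int \<lfloor>x\<rfloor> - 1)\<bar>) \<longlongrightarrow> 0) at_top"
    by simp
  have bound: "\<bar>g (y + t) - g y - t * h y\<bar> \<le> \<bar>h y - h (y - 1)\<bar>"
    if y: "m < y - 1" and t: "0 \<le> t" "t \<le> 1" for y t
    using g
  proof
    assume "convex_on {m<..} g"
    then show ?thesis
      by (rule convex_unit_step_bound) (use y t rec in auto)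
  next
    \<comment> \<open>The bound is invariant under changing the signs of \<open>g\<close> and
      \<open>h\<close> together.\<close>
    assume "concave_on {m<..} g"
    then have "convex_on {m<..} (\<lambda>x. - g x)"
      by (simp add: concave_on_def)
    then have "\<bar>- g (y + t) - - g y - t * - h y\<bar> \<le> \<bar>- h y - - h (y - 1)\<bar>"
      by (rule convex_unit_step_bound) (use y t rec in auto)
    then show ?thesis by linarith
  qed
  show "eventually (\<lambda>x. norm (g x - g (of_int \<lfloor>x\<rfloor>) - frac x * h (of_int \<lfloor>x\<rfloor>))
          \<le> \<bar>h (of_int \<lfloor>x\<rfloor>) - h (of_int \<lfloor>x\<rfloor> - 1)\<bar>) at_top"
    \<comment> \<open>The left neighbour \<open>\<lfloor>x\<rfloor> - 1\<close> must also lie beyond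
      \<open>m\<close>; rounding down costs less than 1.\<close>
    using eventually_gt_at_top[of "m + 2"]
  proof eventually_elim
    case (elim x)
    have "m < of_int \<lfloor>x\<rfloor> - 1" using elim by linarith
    moreover have "0 \<le> frac x" "frac x \<le> 1" "of_int \<lfloor>x\<rfloor> + frac x = x"
      by (auto simp: frac_def less_imp_le[OF frac_lt_1, unfolded frac_def])
    ultimately show ?case
      using bound[of "of_int \<lfloor>x\<rfloor>" "frac x"] by simp
  qed
qed

section \<open>The principal logarithm of an affine function\<close>

text \<open>Both \<open>b\<close> and \<open>x + c\<close> lie in the right half-plane, so their
  arguments are below pi/2 in absolute value. The sum of the arguments stays inside (-pi, pi), and
  the principal logarithm is additive without a multiple of 2 pi i.\<close>

lemma Ln_affine_eq:
  fixes b c :: complex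
  assumes b: "0 < Re b" and x: "0 < x" "0 < x + Re c"
  shows "Ln (b * (of_real x + c)) = Ln b + of_real (ln x) + Ln (1 + c * of_real (1 / x))"
proof -
  have e: "of_real x + c = of_real x * (1 + c * of_real (1 / x))"
    using x by (simp add: field_simps)
  have nz: "1 + c * of_real (1 / x) \<noteq> 0"
    using x e by (auto simp: complex_eq_iff)
  have xc: "Ln (of_real x + c) = of_real (ln x) + Ln (1 + c * of_real (1 / x))"
    unfolding e using x nz by (simp add: Ln_times_of_real Ln_of_real)
  have "\<bar>Im (Ln b)\<bar> < pi / 2" "\<bar>Im (Ln (of_real x + c))\<bar> < pi / 2"
    using b x by (simp_all only: Re_Ln_pos_lt_imp plus_complex.sel Re_complex_of_real)
  moreover have "b \<noteq> 0" "of_real x + c \<noteq> 0"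
    using b x by (auto simp: complex_eq_iff)
  ultimately have "Ln (b * (of_real x + c)) = Ln b + Ln (of_real x + c)"
    by (intro Ln_times_simple) auto
  then show ?thesis by (simp add: xc)
qed

text \<open>With w = 1/x this is the difference quotient at 0 of Ln (1 + c w), whose derivative
  there is c.\<close>

lemma tendsto_mult_Ln_one_plus:
  "((\<lambda>x. of_real x * Ln (1 + c * of_real (1 / x))) \<longlongrightarrow> c) at_top"
proof -
  have "((\<lambda>w. Ln (1 + c * w)) has_field_derivative c) (at 0)"
    by (auto intro!: derivative_eq_intros)
  then have *: "(\<lambda>w. Ln (1 + c * w) / w) \<midarrow>0\<rightarrow> c"
    by (simp add: has_field_derivative_iff)
  have "filterlim (\<lambda>x. complex_of_real (1 / x)) (at 0) at_top"
    unfolding filterlim_at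
  proof
    have "((\<lambda>x::real. 1 / x) \<longlongrightarrow> 0) at_top" by real_asymp
    from tendsto_of_real[OF this]
    show "((\<lambda>x. complex_of_real (1 / x)) \<longlongrightarrow> 0) at_top"
      by (simp only: of_real_0)
    show "eventually (\<lambda>x. complex_of_real (1 / x) \<in> UNIV \<and> complex_of_real (1 / x) \<noteq> 0) at_top"
      using eventually_gt_at_top[of 0] by eventually_elim simp
  qed
  from filterlim_compose[OF * this] show ?thesis
    by (simp add: field_simps)
qed

lemma tendsto_Ln_one_plus:
  "((\<lambda>x. Ln (1 + c * of_real (1 / x))) \<longlongrightarrow> 0) at_top"
proof -
  have "((\<lambda>x::real. 1 / x) \<longlongrightarrow> 0) at_top" by real_asymp
  then have "((\<lambda>x. Ln (1 + c * of_real (1 / x))) \<longlongrightarrow> Ln (1 + c * of_real 0)) at_top"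
    by (intro tendsto_intros) auto
  then show ?thesis by simp
qed

text \<open>\<open>frac x\<close> has no limit, but it cancels the first-order term: with
  \<open>\<lfloor>x\<rfloor> = x * (1 + u)\<close> and \<open>x * u = - frac x\<close>, the
  expression is \<open>x * (ln (1 + u) - u)\<close>. This is O(x u^2) = O(1/x).\<close>

lemma tendsto_floor_ln:
  "((\<lambda>x. x * (ln (of_int \<lfloor>x\<rfloor>) - ln x) + frac x) \<longlongrightarrow> (0::real)) at_top"
proof (rule Lim_null_comparison)
  show "((\<lambda>x::real. 2 / x) \<longlongrightarrow> 0) at_top" by real_asymp
  show "eventually (\<lambda>x::real. norm (x * (ln (of_int \<lfloor>x\<rfloor>) - ln x) + frac x) \<le> 2 / x) at_top"
    \<comment> \<open>From 2 on, |u| is at most 1/2, as the quadratic bound for ln (1 + u) - u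
      requires.\<close>
    using eventually_ge_at_top[of 2]
  proof eventually_elim
    case (elim x)
    define u where "u = - (frac x / x)"
    have t: "0 \<le> frac x" "frac x \<le> 1" by (auto simp: less_imp_le[OF frac_lt_1])
    have u: "\<bar>u\<bar> \<le> 1 / x" using t elim by (auto simp: u_def divide_right_mono)
    also have "\<dots> \<le> 1 / 2" using elim by (simp add: field_simps)
    finally have u2: "\<bar>u\<bar> \<le> 1 / 2" .
    have f: "of_int \<lfloor>x\<rfloor> = x * (1 + u)" using elim by (simp add: u_def frac_def field_simps)
    have "x * (ln (of_int \<lfloor>x\<rfloor>) - ln x) + frac x = x * (ln (1 + u) - u)"
      using elim u2 unfolding f by (simp add: ln_mult) (simp add: u_def algebra_simps)
    then have "norm (x * (ln (of_int \<lfloor>x\<rfloor>) - ln x) + frac x) = x * \<bar>ln (1 + u) - u\<bar>"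
      using elim by (simp add: abs_mult)
    also have "\<dots> \<le> x * (2 * u\<^sup>2)"
      using elim abs_ln_one_plus_x_minus_x_bound[OF u2] by (intro mult_left_mono) auto
    also have "\<dots> \<le> x * (2 * (1 / x)\<^sup>2)"
      using elim u by (intro mult_left_mono power2_le_iff_abs_le[THEN iffD2]) auto
    also have "\<dots> = 2 / x" using elim by (simp add: power2_eq_square)
    finally show ?case .
  qed
qed


lemma eulerian_domain_eq: "eulerian_domain a b = {max 0 (1 - Re (a / b))<..}"
  by (auto simp: eulerian_domain_def)

lemma Ln_affine_tendsto:
  assumes b: "0 < Re b"
  shows "((\<lambda>x. Ln (b * (of_real x + c)) - Ln b - of_real (ln x)) \<longlongrightarrow> 0) at_top"
proof (rule Lim_transform_eventually)
  show "((\<lambda>x. Ln (1 + c * of_real (1 / x))) \<longlongrightarrow> 0) at_top"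
    by (rule tendsto_Ln_one_plus)
  show "eventually (\<lambda>x. Ln (1 + c * of_real (1 / x))
      = Ln (b * (of_real x + c)) - Ln b - of_real (ln x)) at_top"
    using eventually_gt_at_top[of "max 0 (- Re c)"]
  proof eventually_elim
    case (elim x)
    then show ?case
      using Ln_affine_eq[OF b, of x c] by simp
  qed
qed

lemma Ln_affine_step_tendsto:
  assumes b: "0 < Re b"
  shows "((\<lambda>x. Ln (b * (of_real (x + 1) + c)) - Ln (b * (of_real x + c))) \<longlongrightarrow> 0) at_top"
proof -
  have "filterlim (\<lambda>x::real. x + 1) at_top at_top" by real_asymp
  note shifted = filterlim_compose[OF Ln_affine_tendsto[OF b, of c] this]
  have "((\<lambda>x::real. ln (x + 1) - ln x) \<longlongrightarrow> 0) at_top" by real_asymp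
  from tendsto_of_real[OF this]
  have "((\<lambda>x. complex_of_real (ln (x + 1) - ln x)) \<longlongrightarrow> 0) at_top" by (simp only: of_real_0)
  from tendsto_add[OF tendsto_diff[OF shifted Ln_affine_tendsto[OF b, of c]] this]
  show ?thesis by simp
qed

section \<open>The Eulerian function between consecutive integers\<close>

text \<open>Log-modulus and phase are treated as two real interpolation problems, whose increments
  are the real and imaginary part of the same principal logarithm. The phase recurrence holds
  exactly, not just modulo 2 pi, so the two errors combine into one complex
  \<open>D\<close>.\<close>

lemma eulerian_function_interpolation:
  assumes b: "0 < Re b" and f: "eulerian_function a b f"
  obtains D :: "real \<Rightarrow> complex" where "(D \<longlongrightarrow> 0) at_top"
    and "eventually (\<lambda>x. f x = f (of_int \<lfloor>x\<rfloor>)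
           * exp (D x + of_real (frac x) * Ln (a + b * of_int \<lfloor>x\<rfloor>))) at_top"
proof -
  define m where "m = max 0 (1 - Re (a / b))"
  define g where "g x = ln (norm (f x))" for x
  define h where "h x = Ln (a + b * of_real x)" for x
  have b0: "b \<noteq> 0" using b by auto
  have dom: "eulerian_domain a b = {m<..}"
    by (simp only: eulerian_domain_eq m_def)
  obtain \<theta> where \<theta>: "\<And>x. m < x \<Longrightarrow> f x = of_real (norm (f x)) * cis (\<theta> x)"
      "\<And>x. m < x \<Longrightarrow> \<theta> (x + 1) = \<theta> x + Arg (a + b * of_real x)"
      "convex_on {m<..} \<theta> \<or> concave_on {m<..} \<theta>"
    using f unfolding eulerian_function_def eulerian_phase_def dom by auto
  have g: "convex_on {m<..} g" and nz: "\<And>x. m < x \<Longrightarrow> f x \<noteq> 0"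
    using f unfolding eulerian_function_def log_convex_on_def dom g_def by auto
  have affine: "a + b * of_real x = b * (of_real x + a / b)" for x
    using b0 by (simp add: field_simps)
  have nz': "a + b * of_real x \<noteq> 0" if "m < x" for x
  proof -
    have "Re (of_real x + a / b) > 0" using that by (simp add: m_def)
    then have "of_real x + a / b \<noteq> 0" by (auto simp del: plus_complex.sel)
    then show ?thesis unfolding affine using b0 by simp
  qed
  have g_rec: "g (x + 1) = g x + Re (h x)" if "m < x" for x
  proof -
    have "f (x + 1) = (a + b * of_real x) * f x"
      using f that nz'[OF that] unfolding eulerian_function_def by (auto simp: m_def)
    then show ?thesis
      using nz[OF that] nz'[OF that] by (simp add: g_def h_def norm_mult ln_mult Re_Ln)
  qed
  have \<theta>_rec: "\<theta> (x + 1) = \<theta> x + Im (h x)" if "m < x" for x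
    using \<theta>(2)[OF that] nz'[OF that] by (simp add: h_def Arg_eq_Im_Ln)
  have h_step: "((\<lambda>x. h (x + 1) - h x) \<longlongrightarrow> 0) at_top"
    using Ln_affine_step_tendsto[OF b, of "a / b"] unfolding h_def affine .
  define D where "D x = Complex (g x - g (of_int \<lfloor>x\<rfloor>) - frac x * Re (h (of_int \<lfloor>x\<rfloor>)))
      (\<theta> x - \<theta> (of_int \<lfloor>x\<rfloor>) - frac x * Im (h (of_int \<lfloor>x\<rfloor>)))" for x
  have "((\<lambda>x. g x - g (of_int \<lfloor>x\<rfloor>) - frac x * Re (h (of_int \<lfloor>x\<rfloor>))) \<longlongrightarrow> 0) at_top"
    using g g_rec tendsto_Re[OF h_step] by (intro convex_interpolation_tendsto) auto
  moreover have "((\<lambda>x. \<theta> x - \<theta> (of_int \<lfloor>x\<rfloor>) - frac x * Im (h (of_int \<lfloor>x\<rfloor>))) \<longlongrightarrow> 0) at_top"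
    using \<theta>(3) \<theta>_rec tendsto_Im[OF h_step] by (intro convex_interpolation_tendsto) auto
  ultimately have "(D \<longlongrightarrow> 0) at_top"
    unfolding D_def by (auto simp: tendsto_complex_iff)
  moreover have "eventually (\<lambda>x. f x = f (of_int \<lfloor>x\<rfloor>)
      * exp (D x + of_real (frac x) * Ln (a + b * of_int \<lfloor>x\<rfloor>))) at_top"
    using eventually_gt_at_top[of "m + 1"]
  proof eventually_elim
    case (elim x)
    define n :: real where "n = of_int \<lfloor>x\<rfloor>"
    have x: "m < x" and n: "m < n" using elim unfolding n_def by linarith+
    have polar: "f y = exp (Complex (g y) (\<theta> y))" if "m < y" for y
      using \<theta>(1)[OF that] nz[OF that] by (simp add: g_def exp_eq_polar exp_of_real[symmetric])
    have "D x + of_real (frac x) * h n = Complex (g x) (\<theta> x) - Complex (g n) (\<theta> n)"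
      by (simp add: D_def n_def complex_eq_iff)
    then have "f x = f n * exp (D x + of_real (frac x) * h n)"
      unfolding polar[OF x] polar[OF n] by (simp add: exp_diff)
    then show ?case by (simp add: h_def n_def)
  qed
  ultimately show thesis by (rule that)
qed

section \<open>Values at the integers and their growth\<close>

lemma eulerian_product_eq:
  fixes a b :: complex
  assumes "b \<noteq> 0"
  shows "(\<Prod>k<n. a + of_nat k * b) = b ^ n * pochhammer (a / b) n"
proof -
  have "(\<Prod>k<n. a + of_nat k * b) = (\<Prod>k<n. b * (a / b + of_nat k))"
    using assms by (intro prod.cong) (auto simp: field_simps)
  then show ?thesis
    by (simp add: prod.distrib pochhammer_prod lessThan_atLeast0)
qed

text \<open>If a/b = -k, the defining product vanishes from the argument k + 1 on, whereas
  log-convexity includes non-vanishing on the domain. Hence Gamma(a/b) is not at a pole, and the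
  claimed constant is nonzero.\<close>

lemma eulerian_parameter_notin_nonpos_Ints:
  assumes b: "0 < Re b" and f: "eulerian_function a b f"
  shows "a / b \<notin> \<int>\<^sub>\<le>\<^sub>0"
proof
  assume "a / b \<in> \<int>\<^sub>\<le>\<^sub>0"
  then obtain k where k: "a / b = - of_nat k"
    by (elim nonpos_Ints_cases')
  have "b \<noteq> 0" using b by auto
  \<comment> \<open>The domain is here x > k + 1, so k + 2 is its smallest integer.\<close>
  define n where "n = k + 2"
  have "n \<ge> 1" by (simp add: n_def)
  then have "f (real n) = b ^ n * pochhammer (a / b) n"
    using f eulerian_product_eq[OF \<open>b \<noteq> 0\<close>, of a n]
    unfolding eulerian_function_def by simp
  also have "pochhammer (a / b) n = 0"
    unfolding k by (simp add: pochhammer_of_nat_eq_0_iff n_def)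
  finally have "f (real n) = 0" by simp
  moreover have "real n \<in> eulerian_domain a b"
    unfolding eulerian_domain_eq k by (simp add: n_def)
  ultimately show False
    using f unfolding eulerian_function_def log_convex_on_def by blast
qed

text \<open>Stirling's quotient for n! is divided by Gauss' approximant of Gamma(c). The latter
  contains (n - 1)! and n^c, so the exponent n + 1/2 of n becomes n + 1/2 + c - 1 = n + c -
  1/2.\<close>

lemma pochhammer_asymptotics:
  fixes c :: complex
  assumes c: "c \<notin> \<int>\<^sub>\<le>\<^sub>0"
  shows "(\<lambda>n. pochhammer c n
            / exp ((of_nat n + c - 1 / 2) * of_real (ln (real n)) - of_nat n))
          \<longlonglongrightarrow> of_real (sqrt (2 * pi)) / Gamma c"
proof (rule Lim_transform_eventually)
  have "(\<lambda>n. exp (complex_of_real (ln (fact n) - (real n + 1/2) * ln (real n) + real n)))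
      \<longlonglongrightarrow> exp (complex_of_real (ln (sqrt (2 * pi))))"
    by (intro tendsto_intros stirling_ln_fact)
  also have "exp (complex_of_real (ln (sqrt (2 * pi)))) = of_real (sqrt (2 * pi))"
    by (simp only: exp_of_real) simp
  finally show "(\<lambda>n. exp (complex_of_real (ln (fact n) - (real n + 1/2) * ln (real n) + real n))
      / Gamma_series' c n) \<longlonglongrightarrow> of_real (sqrt (2 * pi)) / Gamma c"
    using c by (intro tendsto_divide Gamma_series'_LIMSEQ) (auto simp: Gamma_eq_zero_iff)
  show "eventually (\<lambda>n. exp (complex_of_real (ln (fact n) - (real n + 1/2) * ln (real n) + real n))
      / Gamma_series' c n = pochhammer c n
            / exp ((of_nat n + c - 1 / 2) * of_real (ln (real n)) - of_nat n)) sequentially"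
    using eventually_gt_at_top[of 0]
  proof eventually_elim
    case (elim n)
    define L where "L = complex_of_real (ln (real n))"
    have f: "(fact n :: complex) = exp L * fact (n - 1)"
      using elim unfolding L_def exp_of_real by (simp add: fact_reduce[OF elim])
    have "exp (complex_of_real (ln (fact n) - (real n + 1/2) * ln (real n) + real n))
        = exp (of_real (ln (fact n))) * exp (- ((of_nat n + 1/2) * L) + of_nat n)"
      unfolding exp_add[symmetric] by (simp add: L_def algebra_simps)
    also have "exp (of_real (ln (fact n))) = (fact n :: complex)"
      unfolding exp_of_real by simp
    also have "fact n * exp (- ((of_nat n + 1/2) * L) + of_nat n)
        = fact (n - 1) * (exp L * exp (- ((of_nat n + 1/2) * L) + of_nat n))"
      by (simp only: f mult_ac)
    also have "exp L * exp (- ((of_nat n + 1/2) * L) + of_nat n)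
        = exp (L - (of_nat n + 1/2) * L + of_nat n)"
      unfolding exp_add[symmetric] by (rule arg_cong[where f = exp]) simp
    finally have e: "exp (complex_of_real (ln (fact n) - (real n + 1/2) * ln (real n) + real n))
        = fact (n - 1) * exp (L - (of_nat n + 1/2) * L + of_nat n)" .
    have "exp (complex_of_real (ln (fact n) - (real n + 1/2) * ln (real n) + real n))
        / Gamma_series' c n = pochhammer c n
          * (exp (L - (of_nat n + 1/2) * L + of_nat n) / exp (c * L))"
      unfolding e Gamma_series'_def by (simp add: L_def)
    also have "exp (L - (of_nat n + 1/2) * L + of_nat n) / exp (c * L)
        = 1 / exp ((of_nat n + c - 1 / 2) * L - of_nat n)"
      by (simp add: divide_simps flip: exp_add exp_diff) (simp add: algebra_simps flip: exp_add)
    finally show ?case by (simp add: L_def)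
  qed
qed

text \<open>With \<open>\<beta> = Ln b\<close> and \<open>c = a / b\<close>, the logarithm of the quotient of \<open>\<Gamma>\<^sub>E\<close> and Euler's formula,
  up to the constant from Stirling's formula and terms tending to 0.\<close>
lemma eulerian_exponent_tendsto:
  fixes c \<beta> :: complex
  shows "((\<lambda>x. (of_int \<lfloor>x\<rfloor> * \<beta> + (of_int \<lfloor>x\<rfloor> + c - 1 / 2) * of_real (ln (of_int \<lfloor>x\<rfloor>)) - of_int \<lfloor>x\<rfloor>)
      + of_real (frac x) * (\<beta> + of_real (ln (of_int \<lfloor>x\<rfloor>)))
      - ((c + of_real x - 1 / 2) * (\<beta> + of_real (ln x) + Ln (1 + (c - 1) * of_real (1 / x)))
         - of_real x)) \<longlongrightarrow> (1 / 2 - c) * \<beta> + (1 - c)) at_top"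
proof -
  have ln_floor: "((\<lambda>x::real. ln (of_int \<lfloor>x\<rfloor>) - ln x) \<longlongrightarrow> 0) at_top"
  proof (rule Lim_transform_eventually)
    have "((\<lambda>x::real. frac x / x) \<longlongrightarrow> 0) at_top"
    proof (rule Lim_null_comparison)
      show "((\<lambda>x::real. 1 / x) \<longlongrightarrow> 0) at_top" by real_asymp
      show "eventually (\<lambda>x::real. norm (frac x / x) \<le> 1 / x) at_top"
        using eventually_gt_at_top[of 0]
        by eventually_elim (auto simp: divide_right_mono less_imp_le[OF frac_lt_1])
    qed
    moreover have "((\<lambda>x::real. 1 / x) \<longlongrightarrow> 0) at_top" by real_asymp
    ultimately have "((\<lambda>x::real. (x * (ln (of_int \<lfloor>x\<rfloor>) - ln x) + frac x) * (1 / x) - frac x / x)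
        \<longlongrightarrow> 0 * 0 - 0) at_top"
      by (intro tendsto_intros tendsto_floor_ln)
    then show "((\<lambda>x::real. (x * (ln (of_int \<lfloor>x\<rfloor>) - ln x) + frac x) * (1 / x) - frac x / x)
        \<longlongrightarrow> 0) at_top" by simp
    show "eventually (\<lambda>x::real. (x * (ln (of_int \<lfloor>x\<rfloor>) - ln x) + frac x) * (1 / x) - frac x / x
        = ln (of_int \<lfloor>x\<rfloor>) - ln x) at_top"
      using eventually_gt_at_top[of 0] by eventually_elim (simp add: field_simps)
  qed
  \<comment> \<open>The exponent regrouped by means of
    \<open>\<lfloor>x\<rfloor> + frac x = x\<close>: the parts of \<beta> growing with x cancel, and
    the floor survives only in two combinations with known limits. The summand 1 - c of the limit
    comes from x times the last logarithm.\<close>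
  have "((\<lambda>x. (1 / 2 - c) * \<beta> + (c - 1 / 2) * of_real (ln (of_int \<lfloor>x\<rfloor>) - ln x)
      + of_real (x * (ln (of_int \<lfloor>x\<rfloor>) - ln x) + frac x)
      - (c - 1 / 2) * Ln (1 + (c - 1) * of_real (1 / x))
      - of_real x * Ln (1 + (c - 1) * of_real (1 / x)))
      \<longlongrightarrow> (1 / 2 - c) * \<beta> + (c - 1 / 2) * of_real 0 + of_real 0 - (c - 1 / 2) * 0 - (c - 1)) at_top"
    by (intro tendsto_add tendsto_diff tendsto_mult tendsto_const tendsto_of_real ln_floor
        tendsto_floor_ln tendsto_Ln_one_plus tendsto_mult_Ln_one_plus)
  moreover have "(1 / 2 - c) * \<beta> + (c - 1 / 2) * of_real (ln (of_int \<lfloor>x\<rfloor>) - ln x)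
      + of_real (x * (ln (of_int \<lfloor>x\<rfloor>) - ln x) + frac x)
      - (c - 1 / 2) * Ln (1 + (c - 1) * of_real (1 / x))
      - of_real x * Ln (1 + (c - 1) * of_real (1 / x))
    = (of_int \<lfloor>x\<rfloor> * \<beta> + (of_int \<lfloor>x\<rfloor> + c - 1 / 2) * of_real (ln (of_int \<lfloor>x\<rfloor>)) - of_int \<lfloor>x\<rfloor>)
      + of_real (frac x) * (\<beta> + of_real (ln (of_int \<lfloor>x\<rfloor>)))
      - ((c + of_real x - 1 / 2) * (\<beta> + of_real (ln x) + Ln (1 + (c - 1) * of_real (1 / x)))
         - of_real x)" for x
    by (simp add: frac_def algebra_simps)
  ultimately show ?thesis by (simp only:) (simp add: algebra_simps)
qed

section \<open>The quotient by Euler's formula and the constant\<close>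

lemma filterlim_nat_floor_at_top: "filterlim (\<lambda>x::real. nat \<lfloor>x\<rfloor>) at_top at_top"
  using filterlim_compose[OF filterlim_nat_sequentially filterlim_floor_sequentially] .

text \<open>For large x the quotient equals \<open>P n * exp (D x + frac x * R n + E x)\<close>
  exactly, with n the floor of x. \<open>P\<close> carries the Gauss-Stirling limit,
  \<open>D\<close> the interpolation error, \<open>R\<close> the error of replacing Ln (a + b n) by
  Ln b + ln n, and \<open>E\<close> the explicit exponent.\<close>

lemma eulerian_asymptotics:
  assumes b: "0 < Re b" and f: "eulerian_function a b f"
  shows "((\<lambda>x. f x / ((a - b + b * of_real x) powr (a / b + of_real x - 1 / 2) * exp (- of_real x)))
     \<longlongrightarrow> of_real (sqrt (2 * pi)) / Gamma (a / b) * exp (- (a / b) + 1) * b powr (1 / 2 - a / b)) at_top"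
proof -
  define c where "c = a / b"
  define \<beta> where "\<beta> = Ln b"
  define G where "G x = (a - b + b * of_real x) powr (c + of_real x - 1 / 2) * exp (- of_real x)" for x
  have b0: "b \<noteq> 0" using b by auto
  obtain D where D: "(D \<longlongrightarrow> 0) at_top" and fD: "eventually (\<lambda>x. f x = f (of_int \<lfloor>x\<rfloor>)
           * exp (D x + of_real (frac x) * Ln (a + b * of_int \<lfloor>x\<rfloor>))) at_top"
    using eulerian_function_interpolation[OF b f] .
  define N where "N n = (of_nat n + c - 1 / 2) * of_real (ln (real n)) - of_nat n" for n
  define P where "P n = pochhammer c n / exp (N n)" for n
  define R where "R x = Ln (b * (of_real x + c)) - \<beta> - of_real (ln x)" for x
  define E where "E x = (of_int \<lfloor>x\<rfloor> * \<beta> + (of_int \<lfloor>x\<rfloor> + c - 1 / 2) * of_real (ln (of_int \<lfloor>x\<rfloor>)) - of_int \<lfloor>x\<rfloor>)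
      + of_real (frac x) * (\<beta> + of_real (ln (of_int \<lfloor>x\<rfloor>)))
      - ((c + of_real x - 1 / 2) * (\<beta> + of_real (ln x) + Ln (1 + (c - 1) * of_real (1 / x)))
         - of_real x)" for x
  have "(P \<longlongrightarrow> of_real (sqrt (2 * pi)) / Gamma c) sequentially"
    unfolding P_def N_def c_def
    by (rule pochhammer_asymptotics[OF eulerian_parameter_notin_nonpos_Ints[OF b f]])
  note P = filterlim_compose[OF this filterlim_nat_floor_at_top]
  have "(R \<longlongrightarrow> 0) at_top"
    unfolding R_def \<beta>_def by (rule Ln_affine_tendsto[OF b])
  note R0 = filterlim_compose[OF this filterlim_of_int_floor_at_top]
  have R: "((\<lambda>x. of_real (frac x) * R (of_int \<lfloor>x\<rfloor>)) \<longlongrightarrow> 0) at_top"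
  proof (rule Lim_null_comparison)
    show "((\<lambda>x::real. norm (R (of_int \<lfloor>x\<rfloor>))) \<longlongrightarrow> 0) at_top"
      using tendsto_norm_zero[OF R0] .
    show "eventually (\<lambda>x. norm (of_real (frac x) * R (of_int \<lfloor>x\<rfloor>)) \<le> norm (R (of_int \<lfloor>x\<rfloor>))) at_top"
      by (intro always_eventually allI)
        (auto simp: norm_mult less_imp_le[OF frac_lt_1] intro!: mult_left_le_one_le)
  qed
  have E: "(E \<longlongrightarrow> (1 / 2 - c) * \<beta> + (1 - c)) at_top"
    unfolding E_def by (rule eulerian_exponent_tendsto)
  have "((\<lambda>x. P (nat \<lfloor>x\<rfloor>) * exp (D x + of_real (frac x) * R (of_int \<lfloor>x\<rfloor>) + E x))
      \<longlongrightarrow> of_real (sqrt (2 * pi)) / Gamma c * exp (0 + 0 + ((1 / 2 - c) * \<beta> + (1 - c)))) at_top"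
    by (intro tendsto_mult P tendsto_exp tendsto_add D R E)
  also have "exp (0 + 0 + ((1 / 2 - c) * \<beta> + (1 - c))) = exp (- c + 1) * b powr (1 / 2 - c)"
    using b0 by (simp add: powr_def \<beta>_def flip: exp_add) (simp add: algebra_simps)
  finally have lim: "((\<lambda>x. P (nat \<lfloor>x\<rfloor>) * exp (D x + of_real (frac x) * R (of_int \<lfloor>x\<rfloor>) + E x))
      \<longlongrightarrow> of_real (sqrt (2 * pi)) / Gamma c * exp (- c + 1) * b powr (1 / 2 - c)) at_top"
    by (simp only: mult.assoc)
  have "eventually (\<lambda>x. P (nat \<lfloor>x\<rfloor>) * exp (D x + of_real (frac x) * R (of_int \<lfloor>x\<rfloor>) + E x)
      = f x / G x) at_top"
    \<comment> \<open>Beyond 1 the floor is a positive integer, where the product formula applies.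
      Beyond 1 - Re c the point x + (c - 1) is in the right half-plane, as
      \<open>Ln_affine_eq\<close> requires for the base of Euler's formula.\<close>
    using fD eventually_gt_at_top[of "max 1 (1 - Re c)"]
  proof eventually_elim
    case (elim x)
    define n where "n = nat \<lfloor>x\<rfloor>"
    have n: "n \<ge> 1" "of_int \<lfloor>x\<rfloor> = real n" "of_int \<lfloor>x\<rfloor> = (of_nat n :: complex)"
      using elim by (auto simp: n_def le_nat_iff)
    have "f (real n) = b ^ n * pochhammer c n"
      using f n(1) eulerian_product_eq[OF b0, of a n]
      unfolding eulerian_function_def by (simp add: c_def)
    also have "b ^ n = exp (of_nat n * \<beta>)"
      using b0 by (simp add: \<beta>_def exp_of_nat_mult)
    finally have fn: "f (real n) = P n * exp (of_nat n * \<beta> + N n)"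
      by (simp add: P_def exp_add)
    have aff: "a + b * of_nat n = b * (of_real (real n) + c)"
      using b0 by (simp add: c_def field_simps)
    have fx: "f x = P n * exp (of_nat n * \<beta> + N n
        + (D x + of_real (frac x) * (R (real n) + \<beta> + of_real (ln (real n)))))"
      using elim(1) unfolding n fn aff by (simp add: R_def exp_add)
    define K where "K = \<beta> + of_real (ln x) + Ln (1 + (c - 1) * of_real (1 / x))"
    have aff': "a - b + b * of_real x = b * (of_real x + (c - 1))"
      using b0 by (simp add: c_def field_simps)
    have "Re (of_real x + (c - 1)) > 0" using elim by simp
    then have "of_real x + (c - 1) \<noteq> 0" by (auto simp del: plus_complex.sel)
    then have "a - b + b * of_real x \<noteq> 0"
      unfolding aff' using b0 by simp
    moreover have "Ln (a - b + b * of_real x) = K"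
      unfolding aff' K_def \<beta>_def by (rule Ln_affine_eq[OF b]) (use elim in auto)
    ultimately have "G x = exp ((c + of_real x - 1 / 2) * K) * exp (- of_real x)"
      unfolding G_def powr_def by simp
    then have "G x = exp ((c + of_real x - 1 / 2) * K - of_real x)"
      unfolding exp_add[symmetric] by simp
    then have "f x / G x = P n * exp (of_nat n * \<beta> + N n
        + (D x + of_real (frac x) * (R (real n) + \<beta> + of_real (ln (real n))))
        - ((c + of_real x - 1 / 2) * K - of_real x))"
      unfolding fx by (simp add: exp_diff)
    also have "of_nat n * \<beta> + N n + (D x + of_real (frac x) * (R (real n) + \<beta> + of_real (ln (real n))))
        - ((c + of_real x - 1 / 2) * K - of_real x)
        = D x + of_real (frac x) * R (real n)
          + (of_nat n * \<beta> + N n + of_real (frac x) * (\<beta> + of_real (ln (real n)))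
             - ((c + of_real x - 1 / 2) * K - of_real x))"
      by (simp add: distrib_left)
    also have "of_nat n * \<beta> + N n + of_real (frac x) * (\<beta> + of_real (ln (real n)))
             - ((c + of_real x - 1 / 2) * K - of_real x) = E x"
      unfolding E_def N_def K_def n by (simp only: add_diff_eq)
    finally show ?case unfolding n by (simp add: n_def)
  qed
  with lim show ?thesis
    unfolding G_def c_def by (rule Lim_transform_eventually)
qed

theorem mainTheorem1:
  fixes a b A :: complex and \<Gamma>\<^sub>E :: "real \<Rightarrow> complex"
  assumes "0 < Re b"
    and "eulerian_function a b \<Gamma>\<^sub>E"
  shows "\<Gamma>\<^sub>E \<sim>[at_top]
           (\<lambda>x. A * (a - b + b * of_real x) powr (a / b + of_real x - 1 / 2) * exp (- of_real x))
         \<longleftrightarrow>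
         A = of_real (sqrt (2 * pi)) / Gamma (a / b) * exp (- (a / b) + 1) * b powr (1 / 2 - a / b)"
proof -
  define G where "G x = (a - b + b * of_real x) powr (a / b + of_real x - 1 / 2) * exp (- of_real x)" for x
  define A\<^sub>0 where "A\<^sub>0 = of_real (sqrt (2 * pi)) / Gamma (a / b) * exp (- (a / b) + 1) * b powr (1 / 2 - a / b)"
  have b0: "b \<noteq> 0" using assms(1) by auto
  have lim: "((\<lambda>x. \<Gamma>\<^sub>E x / G x) \<longlongrightarrow> A\<^sub>0) at_top"
    unfolding G_def A\<^sub>0_def using eulerian_asymptotics[OF assms] .
  have A\<^sub>0: "A\<^sub>0 \<noteq> 0"
    using eulerian_parameter_notin_nonpos_Ints[OF assms] b0 by (simp add: A\<^sub>0_def Gamma_eq_zero_iff)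
  have "\<Gamma>\<^sub>E \<sim>[at_top] (\<lambda>x. A * G x) \<longleftrightarrow> A = A\<^sub>0"
  proof
    assume asy: "\<Gamma>\<^sub>E \<sim>[at_top] (\<lambda>x. A * G x)"
    \<comment> \<open>Since the limit is nonzero, \<open>\<Gamma>\<^sub>E\<close> is eventually
      nonzero, so the default value 1 for 0/0 in the definition of asymptotic equivalence cannot
      occur.\<close>
    have ev: "eventually (\<lambda>x. \<Gamma>\<^sub>E x / G x \<noteq> 0) at_top"
      using lim A\<^sub>0 by (rule tendsto_imp_eventually_ne)
    from asymp_equivD[OF asy]
    have "((\<lambda>x. if \<Gamma>\<^sub>E x = 0 \<and> A * G x = 0 then 1 else \<Gamma>\<^sub>E x / (A * G x)) \<longlongrightarrow> 1) at_top" .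
    moreover have "eventually (\<lambda>x. (if \<Gamma>\<^sub>E x = 0 \<and> A * G x = 0 then 1 else \<Gamma>\<^sub>E x / (A * G x))
        = \<Gamma>\<^sub>E x / G x / A) at_top"
      using ev by eventually_elim auto
    ultimately have "((\<lambda>x. \<Gamma>\<^sub>E x / G x / A) \<longlongrightarrow> 1) at_top"
      by (rule Lim_transform_eventually)
    moreover have "((\<lambda>x. \<Gamma>\<^sub>E x / G x / A) \<longlongrightarrow> A\<^sub>0 / A) at_top"
      unfolding divide_inverse[of _ A] by (intro tendsto_mult lim tendsto_const)
    ultimately have "A\<^sub>0 / A = 1"
      using tendsto_unique trivial_limit_at_top_linorder by blast
    \<comment> \<open>For A = 0 the quotient is 0 by the convention on division by zero,
      contradicting 1.\<close>
    then show "A = A\<^sub>0" by (cases "A = 0") auto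
  next
    assume "A = A\<^sub>0"
    have "((\<lambda>x. \<Gamma>\<^sub>E x / G x / A\<^sub>0) \<longlongrightarrow> A\<^sub>0 / A\<^sub>0) at_top"
      by (intro tendsto_divide lim tendsto_const A\<^sub>0)
    then show "\<Gamma>\<^sub>E \<sim>[at_top] (\<lambda>x. A * G x)"
      using A\<^sub>0 \<open>A = A\<^sub>0\<close> by (intro asymp_equivI') (simp add: mult.commute)
  qed
  then show ?thesis by (simp only: G_def A\<^sub>0_def mult.assoc)
qed

end
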